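(* Let $K$ be an $(n,d,\lambda)$-graph and let $G=K\times K_2$ be its Kronecker double cover. Then $\sigma(G)>(d-\lambda)/2$.
   Context: An $(n,d,\lambda)$-graph is a $d$-regular graph on $n$ vertices, possibly with loops (a loop contributes $1$ to the degree and to the diagonal of the adjacency matrix), in which every adjacency eigenvalue different from $\pm d$ has absolute value at most $\lambda$. The Kronecker double cover $K\times K_2$ has vertex set $V(K)\times\{0,1\}$, with $(u,i)$ adjacent to $(v,1-i)$ whenever $uv$ is an edge of $K$ (including $u=v$ when $u$ carries a loop). For a graph $G$, $\sigma(G)$ is the minimum of the maximum degree of $G[U]$ over vertex sets $U$ with $|U|>\alpha(G)$, $\alpha$ the independence number (here $\alpha(G)=n$).
   Formalization: λ is required to be nonnegative; otherwise the claim fails when all eigenvalues are ±d, e.g. for a single looped vertex (n=d=1) with λ=−1, where σ(G)=1=(d−λ)/2. *)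

theory Defs
  imports
    "Graph_Theory.Graph_Theory"
    "Jordan_Normal_Form.Char_Poly"
    "HOL-Library.Extended_Real"
begin

text \<open>
  A finite undirected graph without parallel edges is a \<^locale>\<open>pair_pseudo_graph\<close>: an edge
  \<open>uv\<close> is the pair of arcs \<open>(u, v)\<close>, \<open>(v, u)\<close>, and a loop at \<open>u\<close> is the single arc \<open>(u, u)\<close>.
  Hence \<^const>\<open>out_degree\<close> is the degree in which a loop counts once.
\<close>

text \<open>The adjacency matrix with respect to an enumeration \<open>xs\<close> of the vertices.\<close>

definition adjacency_matrix :: "('a, 'b) pre_digraph \<Rightarrow> 'a list \<Rightarrow> real mat" where
  "adjacency_matrix G xs =
     mat (length xs) (length xs) (\<lambda>(i, j). if xs ! i \<rightarrow>\<^bsub>G\<^esub> xs ! j then 1 else 0)"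

text \<open>
  Different enumerations give permutation-similar matrices, so the choice of \<open>xs\<close> is immaterial;
  for an undirected graph the matrix is symmetric, so its real eigenvalues are all its eigenvalues.
\<close>

definition adjacency_eigenvalue :: "('a, 'b) pre_digraph \<Rightarrow> real \<Rightarrow> bool" where
  "adjacency_eigenvalue G \<mu> \<longleftrightarrow>
     (\<exists>xs. distinct xs \<and> set xs = verts G \<and> eigenvalue (adjacency_matrix G xs) \<mu>)"

text \<open>
  As a bound on absolute values, \<open>lam\<close> is nonnegative. This has to be said explicitly because
  there may be no eigenvalue other than \<open>\<plusminus>d\<close>.
\<close>

definition ndl_graph :: "nat \<Rightarrow> nat \<Rightarrow> real \<Rightarrow> 'a pair_pre_digraph \<Rightarrow> bool" where
  "ndl_graph n d lam K \<longleftrightarrow>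
     pair_pseudo_graph K \<and>
     card (pverts K) = n \<and>
     (\<forall>v \<in> pverts K. out_degree K v = d) \<and>
     0 \<le> lam \<and>
     (\<forall>\<mu>. adjacency_eigenvalue K \<mu> \<longrightarrow> \<mu> \<noteq> real d \<longrightarrow> \<mu> \<noteq> - real d \<longrightarrow> \<bar>\<mu>\<bar> \<le> lam)"

definition double_cover :: "'a pair_pre_digraph \<Rightarrow> ('a \<times> nat) pair_pre_digraph" where
  "double_cover K =
     \<lparr> pverts = pverts K \<times> {0, 1},
       parcs = {((u, i), (v, 1 - i)) | u v i. (u, v) \<in> parcs K \<and> i \<in> {0, 1}} \<rparr>"

definition independent_set :: "('a, 'b) pre_digraph \<Rightarrow> 'a set \<Rightarrow> bool" where
  "independent_set G S \<longleftrightarrow> S \<subseteq> verts G \<and> (\<forall>u \<in> S. \<forall>v \<in> S. \<not> u \<rightarrow>\<^bsub>G\<^esub> v)"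

definition independence_number :: "('a, 'b) pre_digraph \<Rightarrow> nat" where
  "independence_number G = Max {card S | S. independent_set G S}"

definition max_degree :: "('a, 'b) pre_digraph \<Rightarrow> nat" where
  "max_degree G = Max (out_degree G ` verts G)"

text \<open>
  The infimum in \<^typ>\<open>enat\<close> is attained whenever some admissible \<open>U\<close> exists, so it is the minimum;
  it is \<open>\<infinity>\<close> if there is none, i.e. if \<open>G\<close> has no edges.
\<close>

definition sigma :: "('a, 'b) pre_digraph \<Rightarrow> enat" where
  "sigma G =
     (INF U \<in> {U. U \<subseteq> verts G \<and> card U > independence_number G}. enat (max_degree (G \<restriction> U)))"

end

theory Submission
  imports Defs "HOL-Analysis.Function_Topology" "HOL-Analysis.Convex"
begin

text \<open>
  Write a vertex set of the double cover as \<open>A \<times> {0} \<union> B \<times> {1}\<close>, where \<open>|A| + |B| > n\<close>. By pigeonhole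
  some component \<open>X \<times> {0} \<union> Y \<times> {1}\<close> of the double cover has more than half of its vertices in this
  set; by regularity \<open>|X| = |Y| = m\<close>. Working in a single component deals with the multiplicity of
  the eigenvalues \<open>\<plusminus>d\<close>: the adjacency operator, applied to functions on \<open>Y\<close> with sum zero, is
  bounded by \<open>\<lambda>\<close>, because its norm there is attained at an eigenfunction of its square and
  connectedness excludes the eigenvalue \<open>d\<^sup>2\<close>. With \<open>\<alpha> = |A \<inter> X|\<close> and \<open>\<beta> = |B \<inter> Y|\<close>, say
  \<open>\<alpha> \<le> \<beta>\<close>, expander mixing and \<open>m < \<alpha> + \<beta>\<close> bound the number of edges between the two sets below
  by \<open>(d - \<lambda>) \<alpha> \<beta> / m\<close>, so some vertex of \<open>A \<inter> X\<close> has at least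
  \<open>(d - \<lambda>) \<beta> / m > (d - \<lambda>) / 2\<close> neighbours in \<open>B \<inter> Y\<close>.
\<close>

text \<open>First-order condition at a minimum: near \<open>t = 0\<close> the linear term dominates,
  so \<open>b \<noteq> 0\<close> would produce negative values. It turns maximality into an
  eigenvalue equation later.\<close>

lemma nonneg_quadratic_linear_coeff_zero:
  fixes b c :: real
  assumes "\<And>t. 0 \<le> 2 * t * b + t\<^sup>2 * c" and "0 \<le> c"
  shows "b = 0"
proof (rule ccontr)
  assume "b \<noteq> 0"
  \<comment> \<open>The minimizer would be \<open>- b / c\<close>; the denominator
    \<open>c + 1\<close> also covers \<open>c = 0\<close>.\<close>
  have "2 * (- b / (c + 1)) * b + (- b / (c + 1))\<^sup>2 * c = - (b\<^sup>2 * (c + 2) / (c + 1)\<^sup>2)"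
    using assms(2) by (simp add: divide_simps power2_eq_square) (simp add: algebra_simps)
  moreover have "b\<^sup>2 * (c + 2) / (c + 1)\<^sup>2 > 0"
    using assms(2) \<open>b \<noteq> 0\<close> by simp
  ultimately show False
    using assms(1)[of "- b / (c + 1)"] by linarith
qed

section \<open>The adjacency operator of a regular symmetric relation\<close>

locale regular_relation =
  fixes V :: "'a set" and r :: "'a rel" and d :: nat
  assumes finite_V: "finite V"
    and r_subset: "r \<subseteq> V \<times> V"
    and sym_r: "sym r"
    and regular: "u \<in> V \<Longrightarrow> card (r `` {u}) = d"
begin

text \<open>Functions are total: a function on \<open>Y\<close> is one that vanishes off
  \<open>Y\<close>. As \<open>r \<subseteq> V \<times> V\<close>, \<open>adj f\<close> depends only
  on \<open>f\<close> on \<open>V\<close> and vanishes off \<open>V\<close>.\<close>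

definition adj :: "('a \<Rightarrow> real) \<Rightarrow> 'a \<Rightarrow> real" where
  "adj f u = (\<Sum>v \<in> r `` {u}. f v)"

definition ip :: "('a \<Rightarrow> real) \<Rightarrow> ('a \<Rightarrow> real) \<Rightarrow> real" where
  "ip f g = (\<Sum>u \<in> V. f u * g u)"

text \<open>\<open>closed_pair X Y\<close> says that \<open>X \<times> {0} \<union> Y \<times> {1}\<close> is a union of components of the double cover.\<close>

definition closed_pair :: "'a set \<Rightarrow> 'a set \<Rightarrow> bool" where
  "closed_pair X Y \<longleftrightarrow> X \<subseteq> V \<and> Y \<subseteq> V \<and> r `` X \<subseteq> Y \<and> r `` Y \<subseteq> X"

text \<open>Connectedness without paths: a nonempty pair is a single component exactly if no smaller
  nonempty closed pair lies inside it. The pair of empty sets also qualifies.\<close>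

definition connected_pair :: "'a set \<Rightarrow> 'a set \<Rightarrow> bool" where
  "connected_pair X Y \<longleftrightarrow> closed_pair X Y \<and>
     (\<forall>X' Y'. closed_pair X' Y' \<longrightarrow> X' \<subseteq> X \<longrightarrow> Y' \<subseteq> Y \<longrightarrow>
        X' = {} \<and> Y' = {} \<or> X' = X \<and> Y' = Y)"

lemma closed_pair_swap: "closed_pair X Y \<Longrightarrow> closed_pair Y X"
  by (auto simp: closed_pair_def)

lemma connected_pair_swap: "connected_pair X Y \<Longrightarrow> connected_pair Y X"
  unfolding connected_pair_def by (meson closed_pair_swap)

lemma nbrs_subset: "r `` S \<subseteq> V"
  using r_subset by auto

lemma finite_nbrs [simp]: "finite (r `` S)"
  using nbrs_subset finite_V by (rule finite_subset)

lemma r_commute: "(u, v) \<in> r \<longleftrightarrow> (v, u) \<in> r"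
  using sym_r by (auto elim: symE)

lemma adj_conv_sum: "adj f u = (\<Sum>v \<in> V. of_bool ((u, v) \<in> r) * f v)"
proof -
  have "V \<inter> {v. (u, v) \<in> r} = r `` {u}"
    using r_subset by auto
  then show ?thesis
    using finite_V by (simp add: adj_def of_bool_def sum.If_cases if_distrib[of "\<lambda>x. x * _"] cong: if_cong)
qed

text \<open>The operator is self-adjoint because its 0/1 kernel is symmetric.\<close>

lemma ip_adj: "ip (adj f) g = ip f (adj g)"
proof -
  have "ip (adj f) g = (\<Sum>u \<in> V. \<Sum>v \<in> V. of_bool ((u, v) \<in> r) * f v * g u)"
    by (simp add: ip_def adj_conv_sum sum_distrib_right)
  also have "\<dots> = (\<Sum>v \<in> V. \<Sum>u \<in> V. of_bool ((u, v) \<in> r) * f v * g u)"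
    by (rule sum.swap)
  also have "\<dots> = ip f (adj g)"
    by (simp add: ip_def adj_conv_sum sum_distrib_left r_commute mult_ac)
  finally show ?thesis .
qed

lemma ip_diff_left: "ip (\<lambda>u. f u - g u) h = ip f h - ip g h"
  by (simp add: ip_def algebra_simps sum_subtractf)

lemma ip_scale_left: "ip (\<lambda>u. c * f u) h = c * ip f h"
  by (simp add: ip_def sum_distrib_left mult.assoc)

lemma ip_diff_right: "ip h (\<lambda>u. f u - g u) = ip h f - ip h g"
  by (simp add: ip_def algebra_simps sum_subtractf)

lemma ip_scale_right: "ip h (\<lambda>u. c * f u) = c * ip h f"
  by (simp add: ip_def sum_distrib_left mult_ac)

lemma adj_add: "adj (\<lambda>u. f u + g u) = (\<lambda>u. adj f u + adj g u)"
  by (simp add: adj_def fun_eq_iff sum.distrib)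

lemma adj_diff: "adj (\<lambda>u. f u - g u) = (\<lambda>u. adj f u - adj g u)"
  by (simp add: adj_def fun_eq_iff sum_subtractf)

lemma adj_scale: "adj (\<lambda>u. c * f u) = (\<lambda>u. c * adj f u)"
  by (simp add: adj_def fun_eq_iff sum_distrib_left)

lemma ip_self_nonneg: "0 \<le> ip f f"
  by (simp add: ip_def sum_nonneg)

lemma ip_self_zero: "ip f f = 0 \<Longrightarrow> u \<in> V \<Longrightarrow> f u = 0"
  using finite_V by (simp add: ip_def sum_nonneg_eq_0_iff)

lemma ip_Cauchy_Schwarz: "(ip f g)\<^sup>2 \<le> ip f f * ip g g"
  unfolding ip_def using Cauchy_Schwarz_ineq_sum[of f g V] by (simp add: power2_eq_square)

lemma ip_indicator: "S \<subseteq> V \<Longrightarrow> ip (indicator S) f = sum f S"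
  unfolding ip_def using finite_V
  by (simp add: indicator_def if_distrib[of "\<lambda>x. x * _"] sum.If_cases Int_absorb1 cong: if_cong)

lemma adj_support:
  assumes "closed_pair X Y" and "\<And>u. u \<notin> Y \<Longrightarrow> f u = 0" and "u \<notin> X"
  shows "adj f u = 0"
  unfolding adj_def
proof (rule sum.neutral, rule ballI)
  fix v assume "v \<in> r `` {u}"
  then have "v \<notin> Y"
    using assms(1,3) r_commute[of u v] by (auto simp: closed_pair_def)
  then show "f v = 0" by (rule assms(2))
qed

lemma adj_indicator:
  assumes "closed_pair X Y"
  shows "adj (indicator Y) = (\<lambda>u. real d * indicator X u)"
proof
  fix u
  show "adj (indicator Y) u = real d * indicator X u"
  proof (cases "u \<in> X")
    case True
    then have "r `` {u} \<subseteq> Y" "u \<in> V" using assms by (auto simp: closed_pair_def)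
    then have "adj (indicator Y) u = real (card (r `` {u}))"
      unfolding adj_def by (simp add: subset_iff)
    then show ?thesis using True \<open>u \<in> V\<close> regular by simp
  next
    case False
    then show ?thesis using adj_support[OF assms] by simp
  qed
qed

text \<open>Self-adjointness moves the operator onto the indicator of \<open>X\<close>, which it
  maps to \<open>d\<close> times the indicator of \<open>Y\<close>. In particular sum zero is
  preserved.\<close>

lemma sum_adj:
  assumes "closed_pair X Y" and "\<And>u. u \<notin> Y \<Longrightarrow> f u = 0"
  shows "sum (adj f) X = real d * sum f Y"
proof -
  have "X \<subseteq> V" "Y \<subseteq> V" using assms(1) by (auto simp: closed_pair_def)
  then have "sum (adj f) X = ip (adj (indicator X)) f"
    by (simp add: ip_indicator ip_adj)
  also have "\<dots> = real d * sum f Y"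
    using adj_indicator[OF closed_pair_swap[OF assms(1)]] \<open>Y \<subseteq> V\<close>
    by (simp add: ip_scale_left ip_indicator)
  finally show ?thesis .
qed

text \<open>Double counting of the arcs between \<open>X\<close> and \<open>Y\<close> gives
  \<open>d * card X = d * card Y\<close>.\<close>

lemma closed_pair_card_eq:
  assumes "closed_pair X Y" and "d > 0"
  shows "card X = card Y"
proof -
  have "X \<subseteq> V" "Y \<subseteq> V" using assms(1) by (auto simp: closed_pair_def)
  then have "finite X" "finite Y" using finite_V finite_subset by auto
  have "sum (adj (indicator Y)) X = real d * sum (indicator Y) Y"
    by (rule sum_adj[OF assms(1)]) simp
  then show ?thesis
    using assms adj_indicator[OF assms(1)] \<open>finite X\<close> \<open>finite Y\<close>
    by (simp add: sum_distrib_left[symmetric])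
qed

section \<open>The spectral gap on one component\<close>

text \<open>\<open>f\<close> maximizes \<open>ip (adj f) (adj f)\<close> on the unit sphere of the functions on \<open>Y\<close> with sum zero.\<close>

lemma extremal_eigenfunction:
  assumes cl: "closed_pair X Y"
    and g: "\<And>u. u \<notin> Y \<Longrightarrow> g u = 0" "sum g Y = 0" "ip g g \<noteq> 0"
  obtains f where "\<And>u. u \<notin> Y \<Longrightarrow> f u = 0" "sum f Y = 0" "ip f f = 1"
    "ip (adj g) (adj g) \<le> ip (adj f) (adj f) * ip g g"
    "\<And>u. adj (adj f) u = ip (adj f) (adj f) * f u"
proof -
  have YV: "Y \<subseteq> V" using cl by (auto simp: closed_pair_def)
  have finY: "finite Y" using YV finite_V finite_subset by auto
  define E where "E = {f :: 'a \<Rightarrow> real. (\<forall>u. u \<notin> Y \<longrightarrow> f u = 0) \<and> sum f Y = 0}"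
  define S where "S = {f \<in> E. ip f f = 1}"
  define Q where "Q = (\<lambda>f. ip (adj f) (adj f))"
  define box where "box = PiE UNIV (\<lambda>u. if u \<in> Y then {- 1..1} else {0 :: real})"
  \<comment> \<open>The support moves from \<open>Y\<close> to \<open>X\<close> and back, and each
    application multiplies the sum by \<open>d\<close>.\<close>
  have E_adj: "adj (adj f) \<in> E" if "f \<in> E" for f
  proof -
    have f: "\<And>u. u \<notin> Y \<Longrightarrow> f u = 0" and s: "sum f Y = 0" using that by (auto simp: E_def)
    have Af: "\<And>u. u \<notin> X \<Longrightarrow> adj f u = 0" using adj_support[OF cl f] .
    have "\<And>u. u \<notin> Y \<Longrightarrow> adj (adj f) u = 0"
      using adj_support[OF closed_pair_swap[OF cl] Af] .
    moreover have "sum (adj (adj f)) Y = 0"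
      using sum_adj[OF closed_pair_swap[OF cl] Af] sum_adj[OF cl f] s by simp
    ultimately show ?thesis by (simp add: E_def)
  qed
  have E_diff: "(\<lambda>u. f u - h u) \<in> E" and E_add: "(\<lambda>u. f u + h u) \<in> E" if "f \<in> E" "h \<in> E" for f h
    using that by (auto simp: E_def sum_subtractf sum.distrib)
  have E_scale: "(\<lambda>u. c * f u) \<in> E" if "f \<in> E" for f c
    using that by (auto simp: E_def sum_distrib_left[symmetric])
  have cont: "continuous_on UNIV (\<lambda>f :: 'a \<Rightarrow> real. f u)" for u
    by simp
  \<comment> \<open>Tychonoff: functions carry the product topology, so a product of compact
    intervals is compact. This makes the unit sphere \<open>S\<close>, a closed subset of
    \<open>box\<close>, compact.\<close>
  have "compact box"
    using compactin_PiE[of "\<lambda>_. euclidean" UNIV "\<lambda>u. if u \<in> Y then {- 1..1} else {0 :: real}"]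
    by (auto simp: box_def euclidean_product_topology)
  moreover have "closed S"
  proof -
    have "S = (\<Inter>u \<in> - Y. {f. f u = 0}) \<inter> {f. sum f Y = 0} \<inter> {f. ip f f = 1}"
      by (auto simp: S_def E_def)
    moreover have "closed {f :: 'a \<Rightarrow> real. f u = 0}" for u
      by (intro closed_Collect_eq cont continuous_intros)
    moreover have "closed {f :: 'a \<Rightarrow> real. sum f Y = 0}"
      by (intro closed_Collect_eq cont continuous_intros)
    moreover have "closed {f :: 'a \<Rightarrow> real. ip f f = 1}"
      unfolding ip_def by (intro closed_Collect_eq cont continuous_intros)
    ultimately show ?thesis by (simp only:) (intro closed_Int closed_INT ballI; simp)
  qed
  moreover have "S \<subseteq> box"
  proof
    fix f assume f: "f \<in> S"
    have "\<bar>f u\<bar> \<le> 1" if "u \<in> Y" for u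
    proof -
      have "f u * f u \<le> ip f f"
        unfolding ip_def using that YV finite_V by (intro member_le_sum) auto
      then have "(f u)\<^sup>2 \<le> 1" using f by (simp add: S_def power2_eq_square)
      then show ?thesis by (simp add: abs_square_le_1)
    qed
    moreover have "f u = 0" if "u \<notin> Y" for u
      using f that by (simp add: S_def E_def)
    ultimately show "f \<in> box" by (auto simp: box_def PiE_iff abs_le_iff minus_le_iff)
  qed
  ultimately have compS: "compact S"
    by (metis compact_Int_closed inf.absorb_iff2)
  have normalize: "(\<lambda>u. (1 / sqrt (ip h h)) * h u) \<in> S" if "h \<in> E" "ip h h \<noteq> 0" for h
  proof -
    have "ip h h > 0" using that ip_self_nonneg[of h] by linarith
    then have "(1 / sqrt (ip h h)) * (1 / sqrt (ip h h)) * ip h h = 1"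
      by simp
    then show ?thesis
      using E_scale[OF that(1)]
      by (simp only: S_def mem_Collect_eq ip_scale_left ip_scale_right mult.assoc simp_thms)
  qed
  have gE: "g \<in> E" using g by (simp add: E_def)
  have "S \<noteq> {}" using normalize[OF gE g(3)] by blast
  moreover have "continuous_on S Q"
    unfolding Q_def ip_def adj_def
    by (rule continuous_on_subset[OF _ subset_UNIV]) (intro cont continuous_intros)
  ultimately obtain f where f: "f \<in> S" and fmax: "\<And>h. h \<in> S \<Longrightarrow> Q h \<le> Q f"
    using continuous_attains_sup[OF compS] by blast
  have fE: "f \<in> E" and f1: "ip f f = 1" using f by (auto simp: S_def)
  \<comment> \<open>Homogeneity extends maximality from the unit sphere to all of
    \<open>E\<close>.\<close>
  have bound: "Q h \<le> Q f * ip h h" if "h \<in> E" for h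
  proof (cases "ip h h = 0")
    case True
    then have "h u = 0" for u
      using ip_self_zero[OF True, of u] that YV by (cases "u \<in> V") (auto simp: E_def)
    then have "adj h u = 0" for u by (simp add: adj_def)
    then show ?thesis using True by (simp add: Q_def ip_def)
  next
    case False
    then have pos: "ip h h > 0" using ip_self_nonneg[of h] by linarith
    have "Q (\<lambda>u. (1 / sqrt (ip h h)) * h u) \<le> Q f"
      by (rule fmax[OF normalize[OF that False]])
    then have "(1 / sqrt (ip h h)) * (1 / sqrt (ip h h)) * Q h \<le> Q f"
      by (simp only: Q_def adj_scale ip_scale_left ip_scale_right mult.assoc)
    then show ?thesis using pos by (simp add: field_simps)
  qed
  \<comment> \<open>The residual of the eigenvalue equation. Comparing \<open>f + t * h\<close> with
    the maximum gives a nonnegative quadratic in \<open>t\<close> whose linear coefficient is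
    \<open>2 * ip h h\<close>, so the residual vanishes.\<close>
  define h where "h = (\<lambda>u. Q f * f u - adj (adj f) u)"
  have hE: "h \<in> E" unfolding h_def by (intro E_diff E_scale E_adj fE)
  have "ip h h = 0"
  proof (rule nonneg_quadratic_linear_coeff_zero)
    have ip_f_h: "ip h h = Q f * ip f h - ip (adj f) (adj h)"
    proof -
      have "ip h h = Q f * ip f h - ip (adj (adj f)) h"
        by (subst (1) h_def) (simp only: ip_diff_left ip_scale_left)
      then show ?thesis by (simp only: ip_adj)
    qed
    fix t
    have exp: "ip (\<lambda>u. p u + t * q u) (\<lambda>u. p u + t * q u) = ip p p + 2 * t * ip p q + t\<^sup>2 * ip q q"
      for p q
      by (simp add: ip_def sum.distrib sum_distrib_left power2_eq_square algebra_simps)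
    have "Q (\<lambda>u. f u + t * h u) \<le> Q f * ip (\<lambda>u. f u + t * h u) (\<lambda>u. f u + t * h u)"
      by (intro bound E_add E_scale fE hE)
    then have "ip (adj f) (adj f) + 2 * t * ip (adj f) (adj h) + t\<^sup>2 * ip (adj h) (adj h)
        \<le> Q f * (1 + 2 * t * ip f h + t\<^sup>2 * ip h h)"
      unfolding Q_def adj_add adj_scale exp f1 .
    then show "0 \<le> 2 * t * ip h h + t\<^sup>2 * (Q f * ip h h - Q h)"
      unfolding Q_def by (subst ip_f_h) (simp add: Q_def algebra_simps)
  next
    show "0 \<le> Q f * ip h h - Q h" using bound[OF hE] by simp
  qed
  then have "h u = 0" for u
    using ip_self_zero[of h u] hE YV by (cases "u \<in> V") (auto simp: E_def)
  then have "adj (adj f) u = Q f * f u" for u by (simp add: h_def)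
  with that[of f] fE f1 bound[OF gE] show ?thesis
    unfolding E_def Q_def by blast
qed

text \<open>The eigenvalue hypothesis on the graph, stated for eigenfunctions;
  \<open>\<bar>\<mu>\<bar> = real d\<close> covers both exceptional values.\<close>

definition spectral_bound :: "real \<Rightarrow> bool" where
  "spectral_bound lam \<longleftrightarrow>
     (\<forall>\<mu> f. (\<forall>u \<in> V. adj f u = \<mu> * f u) \<longrightarrow> (\<exists>u \<in> V. f u \<noteq> 0) \<longrightarrow> \<bar>\<mu>\<bar> = real d \<or> \<bar>\<mu>\<bar> \<le> lam)"

text \<open>By the maximum principle the set where \<open>f\<close> is maximal is closed under walks of length two.\<close>

lemma top_eigenfunction_constant:
  assumes conn: "connected_pair X Y"
    and eig: "\<And>u. adj (adj f) u = (real d)\<^sup>2 * f u"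
    and "y \<in> Y" "y' \<in> Y"
  shows "f y = f y'"
proof -
  have cl: "closed_pair X Y" using conn by (simp add: connected_pair_def)
  have XV: "X \<subseteq> V" and YV: "Y \<subseteq> V" using cl by (auto simp: closed_pair_def)
  have finY: "finite Y" using YV finite_V finite_subset by auto
  define m where "m = Max (f ` Y)"
  define Z where "Z = {z \<in> Y. f z = m}"
  have le: "f z \<le> m" if "z \<in> Y" for z
    unfolding m_def using finY that by simp
  have "m \<in> f ` Y"
    unfolding m_def using finY \<open>y \<in> Y\<close> by (intro Max_in) auto
  then have "Z \<noteq> {}" by (auto simp: Z_def)
  have walk: "w \<in> Z" if z: "z \<in> Z" and zx: "(z, x) \<in> r" and xw: "(x, w) \<in> r" for z x w
  proof -
    have zY: "z \<in> Y" "f z = m" using z by (auto simp: Z_def)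
    have sub: "r `` {x} \<subseteq> Y" if "x \<in> r `` {z}" for x
      using cl that zY unfolding closed_pair_def by blast
    have cards: "card (r `` {x}) = d" if "x \<in> r `` {z}" for x
      using that r_subset by (intro regular) auto
    \<comment> \<open>The defects \<open>m - f w\<close> over all two-step walks from
      \<open>z\<close> are nonnegative and add up to
      \<open>d\<^sup>2 * m - d\<^sup>2 * f z = 0\<close>, so each of them is zero.\<close>
    have "(\<Sum>x \<in> r `` {z}. \<Sum>w \<in> r `` {x}. m - f w)
        = (\<Sum>x \<in> r `` {z}. real d * m) - adj (adj f) z"
      by (simp add: adj_def sum_subtractf cards)
    also have "\<dots> = 0"
      using zY YV regular[of z] by (auto simp: eig power2_eq_square)
    finally have "(\<Sum>x \<in> r `` {z}. \<Sum>w \<in> r `` {x}. m - f w) = 0" .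
    moreover have nn: "0 \<le> m - f w" if "x \<in> r `` {z}" "w \<in> r `` {x}" for x w
      using le[of w] sub[OF that(1)] that(2) by auto
    ultimately have "(\<Sum>w \<in> r `` {x}. m - f w) = 0"
      using zx by (subst (asm) sum_nonneg_eq_0_iff) (auto intro!: sum_nonneg)
    then have "m - f w = 0"
      using xw zx nn by (subst (asm) sum_nonneg_eq_0_iff) auto
    moreover have "w \<in> Y" using sub zx xw by auto
    ultimately show ?thesis by (simp add: Z_def)
  qed
  \<comment> \<open>\<open>Z\<close> and its neighbourhood form a nonempty closed pair inside
    \<open>(X, Y)\<close>; connectedness makes it the whole pair.\<close>
  have "Z \<subseteq> V" using YV by (auto simp: Z_def)
  moreover have "r `` (r `` Z) \<subseteq> Z" using walk by blast
  ultimately have "closed_pair (r `` Z) Z"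
    by (simp add: closed_pair_def nbrs_subset)
  moreover have "r `` Z \<subseteq> X" "Z \<subseteq> Y" using cl by (auto simp: closed_pair_def Z_def)
  ultimately have "Z = Y"
    using conn \<open>Z \<noteq> {}\<close> unfolding connected_pair_def by blast
  then have "y \<in> Z" "y' \<in> Z" using assms(3,4) by auto
  then show ?thesis by (simp add: Z_def)
qed

text \<open>The best constant is the eigenvalue \<open>\<mu>\<^sup>2\<close> of the extremal
  eigenfunction. If \<open>\<mu> = d\<close>, that function is constant on \<open>Y\<close>,
  contradicting sum zero and norm one; otherwise \<open>\<mu> \<le> lam\<close>.\<close>

lemma adj_contraction:
  assumes conn: "connected_pair X Y" and sb: "spectral_bound lam"
    and g: "\<And>u. u \<notin> Y \<Longrightarrow> g u = 0" "sum g Y = 0"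
  shows "ip (adj g) (adj g) \<le> lam\<^sup>2 * ip g g"
proof (cases "ip g g = 0")
  have cl: "closed_pair X Y" using conn by (simp add: connected_pair_def)
  have XV: "X \<subseteq> V" and YV: "Y \<subseteq> V" using cl by (auto simp: closed_pair_def)
  {
    case True
    then have "g u = 0" for u
      using ip_self_zero[OF True, of u] g(1) YV by (cases "u \<in> V") auto
    then have "adj g u = 0" for u by (simp add: adj_def)
    then show ?thesis using True by (simp add: ip_def)
  next
    case False
    obtain f where f: "\<And>u. u \<notin> Y \<Longrightarrow> f u = 0" "sum f Y = 0" "ip f f = 1"
      and le: "ip (adj g) (adj g) \<le> ip (adj f) (adj f) * ip g g"
      and eig: "\<And>u. adj (adj f) u = ip (adj f) (adj f) * f u"
      using extremal_eigenfunction[OF cl g False] by blast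
    define \<mu> where "\<mu> = sqrt (ip (adj f) (adj f))"
    have \<mu>: "0 \<le> \<mu>" and sq: "ip (adj f) (adj f) = \<mu>\<^sup>2"
      using ip_self_nonneg by (simp_all add: \<mu>_def)
    obtain y where y: "y \<in> Y" "f y \<noteq> 0"
    proof (rule ccontr)
      assume "\<not> thesis"
      with that f(1) have "f u = 0" for u by (cases "u \<in> Y") auto
      then show False using f(3) by (simp add: ip_def)
    qed
    have "\<mu> \<noteq> real d"
    proof
      assume "\<mu> = real d"
      then have "f z = f y" if "z \<in> Y" for z
        using top_eigenfunction_constant[OF conn _ that y(1)] eig sq by simp
      then have "sum f Y = real (card Y) * f y" by simp
      moreover have "card Y \<noteq> 0"
        using y(1) finite_subset[OF YV finite_V] by auto
      ultimately show False using f(2) y(2) by simp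
    qed
    moreover have "\<mu> = real d \<or> \<mu> \<le> lam"
    proof -
      \<comment> \<open>Factor \<open>adj\<^sup>2 - \<mu>\<^sup>2\<close>: either \<open>p\<close>
        is an eigenfunction for \<open>\<mu>\<close>, or \<open>p\<close> vanishes on
        \<open>V\<close> and \<open>f\<close> is one for \<open>- \<mu>\<close>.\<close>
      define p where "p = (\<lambda>u. adj f u + \<mu> * f u)"
      have p: "adj p u = \<mu> * p u" for u
        unfolding p_def by (simp add: adj_add adj_scale eig sq power2_eq_square algebra_simps)
      show ?thesis
      proof (cases "\<exists>u \<in> V. p u \<noteq> 0")
        case True
        moreover have "\<forall>u \<in> V. adj p u = \<mu> * p u" using p by simp
        ultimately have "\<bar>\<mu>\<bar> = real d \<or> \<bar>\<mu>\<bar> \<le> lam"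
          using sb unfolding spectral_bound_def by blast
        then show ?thesis using \<mu> by simp
      next
        case False
        then have "\<forall>u \<in> V. adj f u = (- \<mu>) * f u" by (auto simp: p_def add_eq_0_iff)
        moreover have "\<exists>u \<in> V. f u \<noteq> 0" using y YV by auto
        ultimately have "\<bar>- \<mu>\<bar> = real d \<or> \<bar>- \<mu>\<bar> \<le> lam"
          using sb unfolding spectral_bound_def by blast
        then show ?thesis using \<mu> by simp
      qed
    qed
    ultimately have "\<mu>\<^sup>2 \<le> lam\<^sup>2" using \<mu> by (simp add: power_mono)
    then have "\<mu>\<^sup>2 * ip g g \<le> lam\<^sup>2 * ip g g" using ip_self_nonneg by (rule mult_right_mono)
    then show ?thesis using le sq by simp
  }
qed

section \<open>Expander mixing\<close>

lemma sum_indicator_Int: "finite S \<Longrightarrow> sum (indicator T) S = real (card (S \<inter> T))"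
  by (simp add: indicator_def sum.If_cases)

text \<open>For \<open>A \<subseteq> X\<close> with \<open>X\<close> nonempty, the component of the
  indicator of \<open>A\<close> orthogonal to the indicator of \<open>X\<close>.\<close>

definition centered :: "'a set \<Rightarrow> 'a set \<Rightarrow> 'a \<Rightarrow> real" where
  "centered X A u = indicator A u - (real (card A) / real (card X)) * indicator X u"

text \<open>This is \<open>card X\<close> times the variance \<open>p * (1 - p)\<close> of a 0/1
  variable with mean \<open>p = card A / card X\<close>.\<close>

lemma ip_centered:
  assumes "A \<subseteq> X" "X \<subseteq> V" "X \<noteq> {}"
  shows "ip (centered X A) (centered X A) = real (card A) * (real (card X) - real (card A)) / real (card X)"
proof -
  have fin: "finite X" "finite A"
    using finite_subset[OF assms(2) finite_V] finite_subset[OF assms(1)] by auto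
  then have "card X \<noteq> 0" using assms by simp
  have eqs: "sum (indicator A) X = real (card A)" "sum (indicator X) A = real (card A)"
    "sum (indicator A) A = real (card A)" "sum (indicator X) X = real (card X)"
    using fin assms by (simp_all add: sum_indicator_Int Int_absorb1 Int_absorb2)
  have "ip (centered X A) (centered X A) = real (card A) - 2 * (real (card A) / real (card X)) * real (card A)
      + (real (card A) / real (card X))\<^sup>2 * real (card X)"
    unfolding centered_def ip_diff_left ip_diff_right ip_scale_left ip_scale_right
    using assms eqs by (simp add: ip_indicator power2_eq_square)
  then show ?thesis using \<open>card X \<noteq> 0\<close> by (simp add: field_simps power2_eq_square)
qed

lemma sum_centered:
  assumes "A \<subseteq> X" "X \<subseteq> V" "X \<noteq> {}"
  shows "sum (centered X A) X = 0"
proof -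
  have fin: "finite X" "finite A"
    using finite_subset[OF assms(2) finite_V] finite_subset[OF assms(1)] by auto
  have "sum (centered X A) X = sum (indicator A) X - (real (card A) / real (card X)) * sum (indicator X) X"
    by (simp add: centered_def sum_subtractf sum_distrib_left)
  then show ?thesis
    using fin assms by (simp add: sum_indicator_Int Int_absorb1)
qed

text \<open>The expander mixing estimate inside one component of the double cover.\<close>

lemma connected_pair_degree_bound:
  assumes conn: "connected_pair X Y" and sb: "spectral_bound lam"
    and lam: "0 \<le> lam" "lam < real d"
    and A: "A \<subseteq> X" and B: "B \<subseteq> Y" and AB: "card A \<le> card B" "card X < card A + card B"
    and D: "\<And>a. a \<in> A \<Longrightarrow> card (r `` {a} \<inter> B) \<le> D"
  shows "(real d - lam) / 2 < real D"
proof -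
  have cl: "closed_pair X Y" using conn by (simp add: connected_pair_def)
  have XV: "X \<subseteq> V" and YV: "Y \<subseteq> V" using cl by (auto simp: closed_pair_def)
  have fin: "finite X" "finite Y" "finite A" "finite B"
    using finite_subset[OF XV finite_V] finite_subset[OF YV finite_V] finite_subset[OF A] finite_subset[OF B]
    by auto
  define m \<alpha> \<beta> where "m = real (card X)" and "\<alpha> = real (card A)" and "\<beta> = real (card B)"
  have cXY: "card Y = card X" using closed_pair_card_eq[OF cl] lam by simp
  have le: "\<alpha> \<le> m" "\<beta> \<le> m" "\<alpha> \<le> \<beta>" and gt: "m < \<alpha> + \<beta>"
    using card_mono[OF fin(1) A] card_mono[OF fin(2) B] AB cXY
    by (simp_all add: m_def \<alpha>_def \<beta>_def)
  have pos: "0 < \<alpha>" "0 < \<beta>" "0 < m" using le gt by linarith+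
  have ne: "X \<noteq> {}" "Y \<noteq> {}" using pos(3) cXY by (auto simp: m_def)
  define a b where "a = centered X A" and "b = centered Y B"
  have b0: "\<And>u. u \<notin> Y \<Longrightarrow> b u = 0" "sum b Y = 0"
    using B sum_centered[OF B YV ne(2)] by (auto simp: b_def centered_def indicator_def)
  \<comment> \<open>From \<open>m - \<alpha> < \<beta>\<close> and
    \<open>m - \<beta> < \<alpha>\<close> both squared norms get the same bound, which makes the
    product in the Cauchy-Schwarz estimate a perfect square.\<close>
  have Ea: "ip a a \<le> \<alpha> * \<beta> / m"
    unfolding a_def ip_centered[OF A XV ne(1)] using gt pos
    by (auto simp: m_def[symmetric] \<alpha>_def[symmetric] intro!: divide_right_mono mult_left_mono)
  have Eb: "ip b b \<le> \<alpha> * \<beta> / m"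
  proof -
    have "\<beta> * (m - \<beta>) \<le> \<beta> * \<alpha>" using gt pos by (intro mult_left_mono) auto
    then show ?thesis
      unfolding b_def ip_centered[OF B YV ne(2)] cXY m_def[symmetric] \<beta>_def[symmetric]
      using pos by (auto simp: mult.commute intro!: divide_right_mono)
  qed
  have "(ip a (adj b))\<^sup>2 \<le> ip a a * ip (adj b) (adj b)"
    by (rule ip_Cauchy_Schwarz)
  also have "\<dots> \<le> ip a a * (lam\<^sup>2 * ip b b)"
    by (intro mult_left_mono adj_contraction[OF conn sb b0] ip_self_nonneg)
  also have "\<dots> \<le> (\<alpha> * \<beta> / m) * (lam\<^sup>2 * (\<alpha> * \<beta> / m))"
    using Ea Eb pos by (intro mult_mono) (auto intro!: mult_left_mono ip_self_nonneg mult_nonneg_nonneg)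
  also have "\<dots> = (lam * (\<alpha> * \<beta> / m))\<^sup>2"
    by (simp add: power2_eq_square)
  finally have "\<bar>ip a (adj b)\<bar> \<le> lam * (\<alpha> * \<beta> / m)"
    using lam pos by (simp add: abs_le_square_iff[symmetric] abs_mult)
  \<comment> \<open>\<open>ip a (adj b)\<close> is the deviation of the number of arcs from
    \<open>A\<close> to \<open>B\<close> from its expected value
    \<open>d * \<alpha> * \<beta> / m\<close>.\<close>
  moreover have "ip a (adj b) = sum (adj (indicator B)) A - real d * (\<alpha> * \<beta> / m)"
  proof -
    have "ip a (adj b) = sum (adj b) A - (\<alpha> / m) * sum (adj b) X"
      unfolding a_def centered_def ip_diff_left ip_scale_left
      using A XV by (simp add: ip_indicator \<alpha>_def m_def)
    moreover have "sum (adj b) X = 0" using sum_adj[OF cl b0(1)] b0(2) by simp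
    moreover have "sum (adj b) A = sum (adj (indicator B)) A - (\<beta> / m) * (real d * \<alpha>)"
    proof -
      have "adj b = (\<lambda>u. adj (indicator B) u - (\<beta> / m) * (real d * indicator X u))"
        unfolding b_def centered_def adj_diff adj_scale adj_indicator[OF cl]
        by (simp add: \<beta>_def m_def cXY)
      then have "sum (adj b) A = sum (adj (indicator B)) A - (\<beta> / m) * (real d * sum (indicator X) A)"
        by (simp only: sum_subtractf sum_distrib_left)
      also have "sum (indicator X) A = \<alpha>"
        using fin A by (simp add: sum_indicator_Int Int_absorb2 \<alpha>_def)
      finally show ?thesis .
    qed
    ultimately show ?thesis by (simp add: mult_ac)
  qed
  moreover have "sum (adj (indicator B)) A \<le> \<alpha> * real D"
  proof -
    have "adj (indicator B) u \<le> real D" if "u \<in> A" for u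
      using D[OF that] by (simp add: adj_def sum_indicator_Int)
    then have "sum (adj (indicator B)) A \<le> real (card A) * real D"
      by (rule sum_bounded_above)
    then show ?thesis by (simp add: \<alpha>_def)
  qed
  ultimately have "(real d - lam) * (\<alpha> * \<beta> / m) \<le> \<alpha> * real D"
    unfolding left_diff_distrib abs_le_iff by linarith
  then have "\<alpha> * ((real d - lam) * (\<beta> / m)) \<le> \<alpha> * real D"
    by (simp add: mult_ac)
  then have "(real d - lam) * (\<beta> / m) \<le> real D"
    using pos(1) by (simp only: mult_le_cancel_left_pos)
  \<comment> \<open>Strictness enters here: \<open>\<alpha> \<le> \<beta>\<close> and
    \<open>m < \<alpha> + \<beta>\<close> give \<open>\<beta> / m > 1 / 2\<close>.\<close>
  moreover have "(real d - lam) * (1 / 2) < (real d - lam) * (\<beta> / m)"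
    using lam pos gt le by (intro mult_strict_left_mono) (auto simp: field_simps)
  ultimately show ?thesis by linarith
qed

section \<open>Reduction to a single component\<close>

text \<open>By symmetry no arc joins a closed pair to its complement.\<close>

lemma closed_pair_diff:
  assumes "closed_pair X Y" "closed_pair X' Y'"
  shows "closed_pair (X - X') (Y - Y')"
proof -
  have "r `` (X - X') \<subseteq> Y - Y'" "r `` (Y - Y') \<subseteq> X - X'"
    using assms sym_r unfolding closed_pair_def sym_def by blast+
  then show ?thesis using assms by (auto simp: closed_pair_def)
qed

text \<open>Take a closed pair of minimal size with the inequality: it passes to one half of any splitting.\<close>

lemma dense_connected_pair:
  assumes "card V < card A + card B" "A \<subseteq> V" "B \<subseteq> V"
  obtains X Y where "connected_pair X Y"
    "card X + card Y < 2 * (card (A \<inter> X) + card (B \<inter> Y))"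
proof -
  define dense where "dense = (\<lambda>(X, Y). closed_pair X Y \<and>
    card X + card Y < 2 * (card (A \<inter> X) + card (B \<inter> Y)))"
  define size where "size = (\<lambda>(X :: 'a set, Y :: 'a set). card X + card Y)"
  have "dense (V, V)"
    using assms nbrs_subset by (auto simp: dense_def closed_pair_def Int_absorb2)
  then obtain P where P: "dense P" and least: "\<And>Q. dense Q \<Longrightarrow> size P \<le> size Q"
    using ex_has_least_nat[of dense "(V, V)" size] by blast
  obtain X Y where XY: "P = (X, Y)" by fastforce
  have cl: "closed_pair X Y" and gt: "card X + card Y < 2 * (card (A \<inter> X) + card (B \<inter> Y))"
    using P by (auto simp: XY dense_def)
  have XV: "X \<subseteq> V" "Y \<subseteq> V" using cl by (auto simp: closed_pair_def)
  then have fin: "finite X" "finite Y"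
    using finite_subset[OF _ finite_V] by auto
  have "connected_pair X Y"
    unfolding connected_pair_def
  proof (intro conjI cl allI impI)
    fix X' Y' assume cl': "closed_pair X' Y'" and sub: "X' \<subseteq> X" "Y' \<subseteq> Y"
    have split: "card S = card S' + card (S - S')" if "finite S" "S' \<subseteq> S" for S S' :: "'a set"
      using that card_mono[OF that] by (simp add: card_Diff_subset finite_subset)
    have sX: "card X = card X' + card (X - X')" and sY: "card Y = card Y' + card (Y - Y')"
      using split fin sub by auto
    have "card (A \<inter> X) = card (A \<inter> X') + card (A \<inter> X - A \<inter> X')"
      "card (B \<inter> Y) = card (B \<inter> Y') + card (B \<inter> Y - B \<inter> Y')"
      using fin sub by (auto intro!: split)
    moreover have "A \<inter> X - A \<inter> X' = A \<inter> (X - X')" "B \<inter> Y - B \<inter> Y' = B \<inter> (Y - Y')" by auto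
    \<comment> \<open>All the cardinalities add over the splitting, so the strict inequality cannot
      fail for both parts. By minimality a dense part has full size and the other part is
      empty.\<close>
    ultimately have "dense (X', Y') \<or> dense (X - X', Y - Y')"
      using gt sX sY cl' closed_pair_diff[OF cl cl'] by (auto simp: dense_def)
    then have "size P \<le> size (X', Y') \<or> size P \<le> size (X - X', Y - Y')"
      using least by blast
    then have "card (X - X') = 0 \<and> card (Y - Y') = 0 \<or> card X' = 0 \<and> card Y' = 0"
      using sX sY by (auto simp: XY size_def)
    then show "X' = {} \<and> Y' = {} \<or> X' = X \<and> Y' = Y"
      using fin sub finite_subset[OF sub(1)] finite_subset[OF sub(2)] by auto
  qed
  then show ?thesis using that gt by blast
qed

text \<open>The bound for one component counts from its smaller side. Which side that is remains
  open, so degrees are bounded in both directions and the pair is swapped if necessary.\<close>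

lemma double_cover_degree_bound:
  assumes sb: "spectral_bound lam" and lam: "0 \<le> lam" "lam < real d"
    and sub: "A \<subseteq> V" "B \<subseteq> V" and gt: "card V < card A + card B"
    and DA: "\<And>a. a \<in> A \<Longrightarrow> card (r `` {a} \<inter> B) \<le> D"
    and DB: "\<And>b. b \<in> B \<Longrightarrow> card (r `` {b} \<inter> A) \<le> D"
  shows "(real d - lam) / 2 < real D"
proof -
  obtain X Y where conn: "connected_pair X Y"
    and dense: "card X + card Y < 2 * (card (A \<inter> X) + card (B \<inter> Y))"
    using dense_connected_pair[OF gt sub] .
  have eq: "card X = card Y"
    using conn closed_pair_card_eq lam by (simp add: connected_pair_def)
  have DA': "card (r `` {a} \<inter> (B \<inter> Y)) \<le> D" if "a \<in> A" for a
    using DA[OF that] by (rule order_trans[rotated]) (auto intro: card_mono)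
  have DB': "card (r `` {b} \<inter> (A \<inter> X)) \<le> D" if "b \<in> B" for b
    using DB[OF that] by (rule order_trans[rotated]) (auto intro: card_mono)
  show ?thesis
  proof (cases "card (A \<inter> X) \<le> card (B \<inter> Y)")
    case True
    then show ?thesis
      using connected_pair_degree_bound[OF conn sb lam, of "A \<inter> X" "B \<inter> Y" D] dense eq DA'
      by simp
  next
    case False
    then show ?thesis
      using connected_pair_degree_bound[OF connected_pair_swap[OF conn] sb lam, of "B \<inter> Y" "A \<inter> X" D]
        dense eq DB'
      by simp
  qed
qed

end

section \<open>Transfer to graphs, matrices and the double cover\<close>

lemma out_degree_pair: "out_degree (with_proj K) u = card (parcs K `` {u})"
proof -
  have "out_arcs (with_proj K) u = Pair u ` (parcs K `` {u})"
    by (auto simp: out_arcs_def)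
  then show ?thesis by (simp add: out_degree_def card_image inj_on_def)
qed

lemma ndl_graph_regular_relation:
  assumes "ndl_graph n d lam K"
  shows "regular_relation (pverts K) (parcs K) d"
proof -
  interpret pair_pseudo_graph K using assms by (simp add: ndl_graph_def)
  show ?thesis
  proof
    show "finite (pverts K)" by (rule pair_finite_verts)
    show "parcs K \<subseteq> pverts K \<times> pverts K" using arc_fst_in_verts arc_snd_in_verts by fastforce
    show "sym (parcs K)" using pair_sym_arcs by (simp add: symmetric_def)
    show "card (parcs K `` {u}) = d" if "u \<in> pverts K" for u
      using assms that by (simp add: ndl_graph_def out_degree_pair)
  qed
qed

text \<open>Listing the values of \<open>f\<close> along any enumeration of the vertices gives an
  eigenvector, nonzero at the index of \<open>u\<close>.\<close>

lemma adjacency_eigenvalueI: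
  assumes fin: "finite (pverts K)" and sub: "parcs K \<subseteq> pverts K \<times> pverts K"
    and eig: "\<And>u. u \<in> pverts K \<Longrightarrow> (\<Sum>v \<in> parcs K `` {u}. f v) = \<mu> * f u"
    and nz: "u \<in> pverts K" "f u \<noteq> 0"
  shows "adjacency_eigenvalue (with_proj K) \<mu>"
proof -
  obtain xs where xs: "set xs = pverts K" "distinct xs"
    using finite_distinct_list[OF fin] by blast
  define N where "N = length xs"
  define v where "v = vec N (\<lambda>i. f (xs ! i))"
  define A where "A = adjacency_matrix (with_proj K) xs"
  have dim: "A \<in> carrier_mat N N" by (simp add: A_def adjacency_matrix_def N_def)
  have bij: "bij_betw ((!) xs) {0..<N} (pverts K)"
    using bij_betw_nth[OF xs(2) _ xs(1)[symmetric]] by (simp add: N_def atLeast0LessThan)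
  have "A *\<^sub>v v = \<mu> \<cdot>\<^sub>v v"
  proof (rule eq_vecI)
    fix i assume "i < dim_vec (\<mu> \<cdot>\<^sub>v v)"
    then have i: "i < N" by (simp add: v_def)
    then have xi: "xs ! i \<in> pverts K" using nth_mem[of i xs] xs(1) by (simp add: N_def)
    have "(A *\<^sub>v v) $ i = (\<Sum>j \<in> {0..<N}. (if (xs ! i, xs ! j) \<in> parcs K then f (xs ! j) else 0))"
      using i by (simp add: A_def adjacency_matrix_def v_def N_def scalar_prod_def
          if_distrib[of "\<lambda>x. x * _"] cong: if_cong)
    also have "\<dots> = (\<Sum>w \<in> pverts K. (if (xs ! i, w) \<in> parcs K then f w else 0))"
      by (rule sum.reindex_bij_betw[OF bij])
    also have "\<dots> = (\<Sum>w \<in> parcs K `` {xs ! i}. f w)"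
      using fin sub by (intro sum.mono_neutral_cong_right) auto
    also have "\<dots> = (\<mu> \<cdot>\<^sub>v v) $ i"
      using eig[OF xi] i by (simp add: v_def)
    finally show "(A *\<^sub>v v) $ i = (\<mu> \<cdot>\<^sub>v v) $ i" .
  qed (use dim in \<open>simp add: v_def\<close>)
  moreover have "v \<noteq> 0\<^sub>v N"
  proof
    assume v0: "v = 0\<^sub>v N"
    obtain i where "i < N" "xs ! i = u"
      using nz(1) unfolding xs(1)[symmetric] in_set_conv_nth N_def by blast
    then show False using nz(2) arg_cong[OF v0, of "\<lambda>v. v $ i"] by (simp add: v_def)
  qed
  moreover have "v \<in> carrier_vec N" by (simp add: v_def)
  ultimately have "eigenvalue A \<mu>"
    using dim by (auto simp: eigenvalue_def eigenvector_def)
  then show ?thesis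
    using xs by (auto simp: adjacency_eigenvalue_def A_def)
qed

lemma double_cover_arc_iff:
  "((u, i), (v, j)) \<in> parcs (double_cover K) \<longleftrightarrow> (u, v) \<in> parcs K \<and> (i = 0 \<and> j = 1 \<or> i = 1 \<and> j = 0)"
  by (auto simp: double_cover_def)

lemma double_cover_verts [simp]: "pverts (double_cover K) = pverts K \<times> {0, 1}"
  by (simp add: double_cover_def)

lemma independence_number_ge:
  assumes "finite (verts G)" "independent_set G S"
  shows "card S \<le> independence_number G"
  unfolding independence_number_def
proof (rule Max_ge)
  have "{card S |S. independent_set G S} \<subseteq> card ` Pow (verts G)"
    by (auto simp: independent_set_def)
  then show "finite {card S |S. independent_set G S}"
    using assms(1) finite_subset by blast
qed (use assms in blast)

lemma max_degree_induced_ge: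
  fixes H :: "'b pair_pre_digraph"
  assumes "finite U" "u \<in> U"
  shows "card (parcs H `` {u} \<inter> U) \<le> max_degree (with_proj H \<restriction> U)"
proof -
  have "out_arcs (with_proj H \<restriction> U) u = Pair u ` (parcs H `` {u} \<inter> U)"
    using assms by (auto simp: out_arcs_def induce_subgraph_def)
  then have "out_degree (with_proj H \<restriction> U) u = card (parcs H `` {u} \<inter> U)"
    by (simp add: out_degree_def card_image inj_on_def)
  then show ?thesis
    unfolding max_degree_def using assms by (metis Max_ge finite_imageI image_eqI induce_subgraph_verts)
qed

text \<open>\<open>enat\<close> is well-ordered, so the infimum of a nonempty family is attained;
  that of the empty family is the top element.\<close>

lemma sigma_cases:
  obtains "sigma G = \<infinity>"
  | U where "U \<subseteq> verts G" "independence_number G < card U" "sigma G = enat (max_degree (G \<restriction> U))"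
proof (cases "{U. U \<subseteq> verts G \<and> card U > independence_number G} = {}")
  case True
  have "sigma G = \<infinity>" unfolding sigma_def True by (simp add: top_enat_def)
  then show ?thesis by (rule that(1))
next
  case False
  then have "sigma G \<in> (\<lambda>U. enat (max_degree (G \<restriction> U))) ` {U. U \<subseteq> verts G \<and> card U > independence_number G}"
    unfolding sigma_def by (metis (no_types, lifting) wellorder_InfI ex_in_conv image_eqI)
  then show ?thesis using that(2) by blast
qed

theorem theorem7p1:
  fixes K :: "'a pair_pre_digraph" and n d :: nat and lam :: real
  assumes "ndl_graph n d lam K"
  shows "ereal_of_enat (sigma (double_cover K)) > ereal ((real d - lam) / 2)"
proof (rule sigma_cases[of "with_proj (double_cover K)"])
  assume "sigma (with_proj (double_cover K)) = \<infinity>"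
  then show ?thesis by simp
next
  interpret regular_relation "pverts K" "parcs K" d
    using assms by (rule ndl_graph_regular_relation)
  let ?G = "with_proj (double_cover K)"
  fix U
  assume U: "U \<subseteq> verts ?G" and gt: "independence_number ?G < card U"
    and sigma: "sigma ?G = enat (max_degree (?G \<restriction> U))"
  define D where "D = max_degree (?G \<restriction> U)"
  define A B where "A = {u. (u, 0) \<in> U}" and "B = {u. (u, 1) \<in> U}"
  have finG: "finite (verts ?G)" using finite_V by simp
  then have finU: "finite U" using U finite_subset by blast
  have sub: "A \<subseteq> pverts K" "B \<subseteq> pverts K" using U by (auto simp: A_def B_def)
  then have finAB: "finite A" "finite B" using finite_subset[OF _ finite_V] by auto
  have UAB: "U = A \<times> {0} \<union> B \<times> {1}" using U by (auto simp: A_def B_def)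
  have lam: "0 \<le> lam" using assms by (simp add: ndl_graph_def)
  have "(real d - lam) / 2 < real D"
  \<comment> \<open>If \<open>lam \<ge> d\<close>, the left side is at most zero and a single edge
    inside \<open>U\<close> suffices.\<close>
  proof (cases "lam < real d")
    case True
    have "spectral_bound lam"
      unfolding spectral_bound_def
    proof (intro allI impI)
      fix \<mu> f
      assume eig: "\<forall>u \<in> pverts K. adj f u = \<mu> * f u" and nz: "\<exists>u \<in> pverts K. f u \<noteq> 0"
      have "adjacency_eigenvalue (with_proj K) \<mu>"
        using adjacency_eigenvalueI[OF finite_V r_subset, of f \<mu>] eig nz by (auto simp: adj_def)
      then show "\<bar>\<mu>\<bar> = real d \<or> \<bar>\<mu>\<bar> \<le> lam"
        using assms by (auto simp: ndl_graph_def)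
    qed
    moreover have "card (pverts K) < card A + card B"
    proof -
      \<comment> \<open>One side of the bipartition is independent, so the independence number is at
        least \<open>card (pverts K)\<close>.\<close>
      have "independent_set ?G (pverts K \<times> {0})"
        by (auto simp: independent_set_def double_cover_arc_iff)
      then have "card (pverts K) < card U"
        using independence_number_ge[OF finG] gt by (fastforce simp: card_cartesian_product)
      also have "card U = card A + card B"
        unfolding UAB using finAB by (subst card_Un_disjoint) (auto simp: card_cartesian_product)
      finally show ?thesis .
    qed
    moreover have "card (parcs K `` {a} \<inter> B) \<le> D" if "a \<in> A" for a
    proof -
      \<comment> \<open>All neighbours of \<open>(a, 0)\<close> lie in the other layer, where
        \<open>U\<close> is a copy of \<open>B\<close>.\<close>
      have "parcs (double_cover K) `` {(a, 0)} \<inter> U = (\<lambda>b. (b, 1)) ` (parcs K `` {a} \<inter> B)"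
        by (auto simp: UAB double_cover_arc_iff)
      then show ?thesis
        using max_degree_induced_ge[OF finU, of "(a, 0)" "double_cover K"] that
        by (simp add: D_def A_def card_image inj_on_def)
    qed
    moreover have "card (parcs K `` {b} \<inter> A) \<le> D" if "b \<in> B" for b
    proof -
      have "parcs (double_cover K) `` {(b, 1)} \<inter> U = (\<lambda>a. (a, 0)) ` (parcs K `` {b} \<inter> A)"
        by (auto simp: UAB double_cover_arc_iff)
      then show ?thesis
        using max_degree_induced_ge[OF finU, of "(b, 1)" "double_cover K"] that
        by (simp add: D_def B_def card_image inj_on_def)
    qed
    ultimately show ?thesis
      using double_cover_degree_bound lam True sub by blast
  next
    case False
    \<comment> \<open>\<open>U\<close> is too large to be independent, so it contains an edge and
      \<open>D\<close> is positive.\<close>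
    have "\<not> independent_set ?G U"
      using independence_number_ge[OF finG, of U] gt by auto
    then obtain u v where uv: "u \<in> U" "v \<in> U" "(u, v) \<in> parcs (double_cover K)"
      using U by (auto simp: independent_set_def)
    then have "0 < card (parcs (double_cover K) `` {u} \<inter> U)"
      using finU by (auto simp: card_gt_0_iff)
    then have "0 < D"
      using max_degree_induced_ge[OF finU uv(1), of "double_cover K"] by (simp add: D_def)
    then show ?thesis using False by simp
  qed
  then show ?thesis by (simp add: sigma D_def)
qed

end
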